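(* Suppose: $\nabla f$ is Lipschitz continuous with constant $L_f>0$; $h$ is proper, closed and convex; $F=f+h$ is bounded below; $f$ is twice continuously differentiable with $\nabla^2 f(x)\succeq\mu I$ for all $x$, where $\mu>0$, and $\nabla^2f$ is Lipschitz continuous with constant $L_H>0$; there is $\kappa_{\mathrm{eg}}>0$ with $\|g_k-\nabla f(x_k)\|\le\kappa_{\mathrm{eg}}\Delta_k$ for all $k$; there are $\bar\kappa\ge\underline\kappa>0$ with $\underline\kappa I\preceq H_k\preceq\bar\kappa I$ for all $k$; with $x^\star$ the minimizer of $F$, the Dennis--Mor\'e condition $$\varrho_k:=\frac{\|(H_k-\nabla^2f(x^\star))(x_{k+1}-x_k)\|}{\|x_{k+1}-x_k\|}\to0\quad\text{as }k\to\infty$$ holds; the line search parameter satisfies $c_2\ge\frac{\kappa_{\mathrm{eg}}^2}{n\underline\kappa(1-2c_1)}$; and $\sum_{k=0}^\infty\Delta_k^2<\infty$. Let $\{x_k\}$ and $\{d_k\}$ be generated by the algorithm ZOPN with exact subproblem solutions and unit initial step size (described in the context). Then for all sufficiently large $k$, $$\|x_{k+1}-x^\star\|\le\frac{\sqrt2\,\kappa_{\mathrm{eg}}}{\mu-\sqrt2\varrho_k}\Delta_k+\frac{\sqrt2\,(L_H\|d_k\|+\varrho_k)}{\mu-\sqrt2\varrho_k}\|x_k-x^\star\|+\frac{L_H}{2\mu}\left(1+\frac{\sqrt2\varrho_k}{\mu-\sqrt2\varrho_k}\right)\|x_k-x^\star\|^2.$$ Furthermore, if $\{\Delta_k\}$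 converges Q-superlinearly to $0$, then $\{x_k\}$ converges R-superlinearly to $x^\star$.
   Context: Setting: $n\ge1$, $F=f+h$ with $f:\mathbb{R}^n\to\mathbb{R}$ and $h:\mathbb{R}^n\to\mathbb{R}\cup\{+\infty\}$. $\|\cdot\|$ is the Euclidean (spectral) norm. Algorithm ZOPN with exact subproblem solutions and unit initial step size. Parameters: $x_0\in\mathrm{dom}\,F$, $c_1\in(0,1/2)$, $c_2>0$, $\beta\in(0,1)$. For $k=0,1,2,\dots$: choose a sampling radius $\Delta_k>0$; compute an approximate gradient $g_k\in\mathbb{R}^n$ of $f$ at $x_k$ and a symmetric positive definite approximate Hessian $H_k$; let $d_k$ be the exact minimizer over $d\in\mathbb{R}^n$ of $g_k^\top d+\frac12d^\top H_kd+h(x_k+d)$; with $\Phi_k:=g_k^\top d_k+h(x_k+d_k)-h(x_k)$, let $t_k=\beta^i$ where $i\ge0$ is the smallest integer such that $F(x_k+t_kd_k)-F(x_k)\le c_1t_k\Phi_k+nc_2\Delta_k^2$; set $x_{k+1}=x_k+t_kd_k$. The iteration is run without a stopping test, and $\varrho_k:=0$ by convention if $x_{k+1}=x_k$. A sequence $a_k\ge0$ converging to $0$ converges Q-superlinearly to $0$ if $a_k>0$ and $a_{k+1}/a_k\to0$. The sequence $\{x_k\}$ converges R-superlinearly to $x^\star$ if $\|x_k-x^\star\|\le a_k$ for all (sufficiently large) $k$ for some sequence $\{a_k\}$ converging Q-superlinearly to $0$. *)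

theory Defs
  imports "HOL-Analysis.Analysis"
begin

section \<open>Extended-real-valued functions\<close>

definition eff_domain :: "('a \<Rightarrow> ereal) \<Rightarrow> 'a set" where
  "eff_domain h = {x. h x < \<infinity>}"

definition ereal_epigraph :: "('a \<Rightarrow> ereal) \<Rightarrow> ('a \<times> real) set" where
  "ereal_epigraph h = {(x, r). h x \<le> ereal r}"

definition proper_fun :: "('a \<Rightarrow> ereal) \<Rightarrow> bool" where
  "proper_fun h \<longleftrightarrow> (\<forall>x. h x \<noteq> -\<infinity>) \<and> eff_domain h \<noteq> {}"

definition closed_fun :: "('a::topological_space \<Rightarrow> ereal) \<Rightarrow> bool" where
  "closed_fun h \<longleftrightarrow> closed (ereal_epigraph h)"

definition convex_fun :: "('a::real_vector \<Rightarrow> ereal) \<Rightarrow> bool" where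
  "convex_fun h \<longleftrightarrow> convex (ereal_epigraph h)"


section \<open>Matrices\<close>

text \<open>
  The type \<^typ>\<open>real^'n^'n\<close> carries the Frobenius norm as its \<^const>\<open>norm\<close>,
  so the spectral norm has to be the operator norm of the induced linear map.
\<close>

definition spectral_norm :: "real^'n^'m \<Rightarrow> real" where
  "spectral_norm A = onorm ((*v) A)"

text \<open>
  Loewner order, by quadratic forms. It is meant for symmetric matrices; symmetry itself is
  not part of the definition.
\<close>

definition loewner_le :: "real^'n^'n \<Rightarrow> real^'n^'n \<Rightarrow> bool" (infix "\<preceq>\<^sub>L" 50) where
  "A \<preceq>\<^sub>L B \<longleftrightarrow> (\<forall>v. v \<bullet> (A *v v) \<le> v \<bullet> (B *v v))"

definition sym_pos_def :: "real^'n^'n \<Rightarrow> bool" where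
  "sym_pos_def A \<longleftrightarrow> transpose A = A \<and> (\<forall>v. v \<noteq> 0 \<longrightarrow> 0 < v \<bullet> (A *v v))"


section \<open>Gradient and Hessian\<close>

text \<open>
  \<open>C2_fun f gradf hessf\<close>: the function \<open>f\<close> is twice continuously differentiable on the whole
  space with gradient \<open>gradf\<close> and Hessian \<open>hessf\<close> (both are determined by \<open>f\<close>).
\<close>

definition C2_fun ::
  "(real^'n \<Rightarrow> real) \<Rightarrow> (real^'n \<Rightarrow> real^'n) \<Rightarrow> (real^'n \<Rightarrow> real^'n^'n) \<Rightarrow> bool" where
  "C2_fun f gradf hessf \<longleftrightarrow>
     (\<forall>x. GDERIV f x :> gradf x) \<and>
     (\<forall>x. (gradf has_derivative (\<lambda>v. hessf x *v v)) (at x)) \<and>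
     continuous_on UNIV hessf"


section \<open>Rates of convergence\<close>

definition Q_superlinear_to_0 :: "(nat \<Rightarrow> real) \<Rightarrow> bool" where
  "Q_superlinear_to_0 a \<longleftrightarrow>
     (\<forall>k. 0 < a k) \<and> a \<longlonglongrightarrow> 0 \<and> (\<lambda>k. a (Suc k) / a k) \<longlonglongrightarrow> 0"

definition R_superlinear_to :: "(nat \<Rightarrow> 'a::real_normed_vector) \<Rightarrow> 'a \<Rightarrow> bool" where
  "R_superlinear_to x l \<longleftrightarrow>
     (\<exists>a. Q_superlinear_to_0 a \<and> (\<forall>\<^sub>F k in sequentially. norm (x k - l) \<le> a k))"


section \<open>Algorithm ZOPN with exact subproblem solutions and unit initial step size\<close>

definition composite_obj :: "('a \<Rightarrow> real) \<Rightarrow> ('a \<Rightarrow> ereal) \<Rightarrow> 'a \<Rightarrow> ereal" where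
  "composite_obj f h x = ereal (f x) + h x"

definition subproblem_obj ::
  "(real^'n \<Rightarrow> ereal) \<Rightarrow> real^'n \<Rightarrow> real^'n \<Rightarrow> real^'n^'n \<Rightarrow> real^'n \<Rightarrow> ereal" where
  "subproblem_obj h x g H d = ereal (g \<bullet> d + 1/2 * (d \<bullet> (H *v d))) + h (x + d)"

definition predicted_decrease ::
  "(real^'n \<Rightarrow> ereal) \<Rightarrow> real^'n \<Rightarrow> real^'n \<Rightarrow> real^'n \<Rightarrow> ereal" where
  "predicted_decrease h x g d = ereal (g \<bullet> d) + h (x + d) - h x"

text \<open>
  Stated in \<^typ>\<open>ereal\<close>: a trial point outside the domain has \<open>F = \<infinity>\<close> and fails the test.
  The iterates \<open>x\<close> lie in the domain, so no difference \<open>\<infinity> - \<infinity>\<close> is ever formed.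
\<close>

definition linesearch_cond ::
  "(real^'n \<Rightarrow> real) \<Rightarrow> (real^'n \<Rightarrow> ereal) \<Rightarrow> real \<Rightarrow> real \<Rightarrow>
    real^'n \<Rightarrow> real^'n \<Rightarrow> real^'n \<Rightarrow> real \<Rightarrow> real \<Rightarrow> bool" where
  "linesearch_cond f h c1 c2 x g d \<Delta> t \<longleftrightarrow>
     composite_obj f h (x + t *\<^sub>R d) - composite_obj f h x
       \<le> ereal (c1 * t) * predicted_decrease h x g d + ereal (real CARD('n) * c2 * \<Delta>\<^sup>2)"

text \<open>
  The approximations \<open>g k\<close> and \<open>H k\<close> are arbitrary: how they are computed from samples is
  irrelevant here, their accuracy is a separate hypothesis.
\<close>

definition ZOPN_run ::
  "(real^'n \<Rightarrow> real) \<Rightarrow> (real^'n \<Rightarrow> ereal) \<Rightarrow> real \<Rightarrow> real \<Rightarrow> real \<Rightarrow>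
    (nat \<Rightarrow> real) \<Rightarrow> (nat \<Rightarrow> real^'n) \<Rightarrow> (nat \<Rightarrow> real^'n^'n) \<Rightarrow>
    (nat \<Rightarrow> real^'n) \<Rightarrow> (nat \<Rightarrow> real) \<Rightarrow> (nat \<Rightarrow> real^'n) \<Rightarrow> bool" where
  "ZOPN_run f h c1 c2 \<beta> \<Delta> g H d t x \<longleftrightarrow>
     0 < c1 \<and> c1 < 1/2 \<and> 0 < c2 \<and> 0 < \<beta> \<and> \<beta> < 1 \<and>
     x 0 \<in> eff_domain (composite_obj f h) \<and>
     (\<forall>k. 0 < \<Delta> k \<and>
          sym_pos_def (H k) \<and>
          is_arg_min (subproblem_obj h (x k) (g k) (H k)) (\<lambda>_. True) (d k) \<and>
          (\<exists>i. t k = \<beta> ^ i \<and>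
               linesearch_cond f h c1 c2 (x k) (g k) (d k) (\<Delta> k) (\<beta> ^ i) \<and>
               (\<forall>j<i. \<not> linesearch_cond f h c1 c2 (x k) (g k) (d k) (\<Delta> k) (\<beta> ^ j))) \<and>
          x (Suc k) = x k + t k *\<^sub>R d k)"

definition dennis_more_ratio ::
  "(nat \<Rightarrow> real^'n^'n) \<Rightarrow> real^'n^'n \<Rightarrow> (nat \<Rightarrow> real^'n) \<Rightarrow> nat \<Rightarrow> real" where
  "dennis_more_ratio H B x k =
     (if x (Suc k) = x k then 0
      else norm ((H k - B) *v (x (Suc k) - x k)) / norm (x (Suc k) - x k))"

end

theory Submission
  imports Defs
begin

text \<open>
  Write \<open>y\<^sub>k = x\<^sub>k + d\<^sub>k\<close>. Fermat's rule for the subproblem and for \<open>F\<close> gives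
  \<open>- (g\<^sub>k + H\<^sub>k d\<^sub>k) \<in> \<partial>h(y\<^sub>k)\<close> and \<open>- \<nabla>f(x\<^sup>\<star>) \<in> \<partial>h(x\<^sup>\<star>)\<close> (lemma \<open>minimizer_imp_subgradient\<close>), so
  monotonicity of \<open>\<partial>h\<close> yields
  \<open>(g\<^sub>k + H\<^sub>k d\<^sub>k - \<nabla>f(x\<^sup>\<star>)) \<bullet> (y\<^sub>k - x\<^sup>\<star>) \<le> 0\<close>. Everything is read off from this inequality
  by splitting its left factor in two ways.

  \<^item> Comparing with \<open>\<nabla>f(y\<^sub>k)\<close> and using that \<open>\<nabla>f\<close> is strongly monotone bounds \<open>\<parallel>y\<^sub>k - x\<^sup>\<star>\<parallel>\<close> by a
    multiple of \<open>\<Delta>\<^sub>k + \<parallel>d\<^sub>k\<parallel>\<close> (\<open>proximal_newton_residual_bound\<close>). The line search accepts all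
    sufficiently small steps, so the step sizes stay away from \<open>0\<close>; as \<open>F\<close> is bounded below and
    \<open>\<Delta>\<^sub>k\<^sup>2\<close> is summable, sufficient decrease makes \<open>\<parallel>d\<^sub>k\<parallel>\<^sup>2\<close> summable. Hence \<open>d\<^sub>k \<rightarrow> 0\<close> and
    \<open>x\<^sub>k \<rightarrow> x\<^sup>\<star>\<close>.

  \<^item> Comparing with \<open>\<nabla>\<^sup>2f(x\<^sup>\<star>) (y\<^sub>k - x\<^sup>\<star>)\<close> gives, with \<open>e\<^sub>k = \<parallel>x\<^sub>k - x\<^sup>\<star>\<parallel>\<close>,
    \<open>(\<mu> - \<rho>\<^sub>k) \<parallel>y\<^sub>k - x\<^sup>\<star>\<parallel> \<le> \<kappa>eg \<Delta>\<^sub>k + \<rho>\<^sub>k e\<^sub>k + (L\<^sub>H / 2) e\<^sub>k\<^sup>2\<close>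
    (\<open>proximal_newton_step_error\<close>), which is stronger than the error bound claimed for
    \<open>x\<^sub>k\<^sub>+\<^sub>1\<close> as soon as \<open>x\<^sub>k\<^sub>+\<^sub>1 = y\<^sub>k\<close>.

  That \<open>x\<^sub>k\<^sub>+\<^sub>1 = y\<^sub>k\<close> for large \<open>k\<close>, i.e. that the unit step is eventually accepted, follows from a
  second-order expansion of \<open>f\<close>: by the Dennis--More condition \<open>H\<^sub>k\<close> and the true Hessian agree
  along \<open>d\<^sub>k\<close> up to \<open>o(1)\<close>, and the slack \<open>c\<^sub>1 < 1/2\<close> absorbs the difference. Finally the error bound is
  a recursion \<open>e\<^sub>k\<^sub>+\<^sub>1 \<le> C \<Delta>\<^sub>k + \<theta>\<^sub>k e\<^sub>k\<close> with \<open>\<theta>\<^sub>k \<rightarrow> 0\<close>, and the solution of the corresponding equation is a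
  Q-superlinear majorant of \<open>e\<^sub>k\<close> (\<open>perturbed_superlinear_recursion\<close>).
\<close>


section \<open>The smooth part\<close>

lemma norm_mult_spectral_norm_le: "norm (A *v v) \<le> spectral_norm A * norm v"
  unfolding spectral_norm_def by (rule onorm) (rule matrix_vector_mul_bounded_linear)

lemma C2_funD:
  assumes "C2_fun f gradf hessf"
  shows "(f has_derivative (\<lambda>v. v \<bullet> gradf y)) (at y)"
    and "(gradf has_derivative (\<lambda>v. hessf y *v v)) (at y)"
  using assms by (auto simp: C2_fun_def gderiv_def)

lemma has_field_derivative_along_line:
  fixes f :: "real^'n \<Rightarrow> real"
  assumes "C2_fun f gradf hessf"
  shows "((\<lambda>s. f (y + s *\<^sub>R w)) has_field_derivative gradf (y + s *\<^sub>R w) \<bullet> w) (at s)"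
proof -
  have "((\<lambda>s. f (y + s *\<^sub>R w)) has_derivative (\<lambda>r. (r *\<^sub>R w) \<bullet> gradf (y + s *\<^sub>R w))) (at s)"
    by (rule has_derivative_compose[OF _ C2_funD(1)[OF assms]]) (auto intro!: derivative_eq_intros)
  then show ?thesis
    unfolding has_field_derivative_def
    by (rule has_derivative_eq_rhs) (simp add: fun_eq_iff inner_commute)
qed

lemma gradient_has_field_derivative_along_line:
  fixes f :: "real^'n \<Rightarrow> real"
  assumes "C2_fun f gradf hessf"
  shows "((\<lambda>s. v \<bullet> gradf (y + s *\<^sub>R w)) has_field_derivative v \<bullet> (hessf (y + s *\<^sub>R w) *v w)) (at s)"
proof -
  have "((\<lambda>s. gradf (y + s *\<^sub>R w)) has_derivative (\<lambda>r. hessf (y + s *\<^sub>R w) *v (r *\<^sub>R w))) (at s)"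
    by (rule has_derivative_compose[OF _ C2_funD(2)[OF assms]]) (auto intro!: derivative_eq_intros)
  from has_derivative_inner_right[OF this, of v] show ?thesis
    by (simp add: has_field_derivative_def matrix_vector_mult_scaleR mult.commute[of _ "v \<bullet> _"])
qed

lemma gradient_strongly_monotone:
  fixes f :: "real^'n \<Rightarrow> real"
  assumes f: "C2_fun f gradf hessf" and hess: "\<And>y. \<mu> *\<^sub>R mat 1 \<preceq>\<^sub>L hessf y"
  shows "\<mu> * (norm (y - z))\<^sup>2 \<le> (gradf y - gradf z) \<bullet> (y - z)"
proof -
  define w where "w = y - z"
  obtain s :: real where "w \<bullet> gradf (z + 1 *\<^sub>R w) - w \<bullet> gradf (z + 0 *\<^sub>R w)
      = (1 - 0) * (w \<bullet> (hessf (z + s *\<^sub>R w) *v w))"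
    using MVT2[OF zero_less_one gradient_has_field_derivative_along_line[OF f, of w z w]] by blast
  moreover have "\<mu> * (norm w)\<^sup>2 \<le> w \<bullet> (hessf (z + s *\<^sub>R w) *v w)"
    using hess[of "z + s *\<^sub>R w"]
    by (simp add: loewner_le_def scaleR_matrix_vector_assoc[symmetric] dot_square_norm)
  ultimately show ?thesis
    by (simp add: w_def inner_diff_left inner_diff_right inner_commute)
qed

lemma gradient_linearization_error:
  fixes f :: "real^'n \<Rightarrow> real"
  assumes f: "C2_fun f gradf hessf"
    and hess: "\<And>y z. spectral_norm (hessf y - hessf z) \<le> L * norm (y - z)"
  shows "norm (gradf y - gradf z - hessf z *v (y - z)) \<le> L / 2 * (norm (y - z))\<^sup>2"
proof -
  define w where "w = y - z"
  define v where "v = gradf y - gradf z - hessf z *v w"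
  define C where "C = L * (norm w)\<^sup>2 * norm v"
  \<comment> \<open>Testing the error with itself reduces the claim to a scalar function on \<open>[0, 1]\<close>;
    subtracting \<open>C/2 s\<^sup>2\<close> makes that function nonincreasing.\<close>
  let ?\<chi> = "\<lambda>s. v \<bullet> gradf (z + s *\<^sub>R w) - s * (v \<bullet> (hessf z *v w)) - C / 2 * s\<^sup>2"
  have "?\<chi> 1 \<le> ?\<chi> 0"
  proof (rule DERIV_nonpos_imp_nonincreasing[of 0 1])
    fix s :: real
    assume s: "0 \<le> s" "s \<le> 1"
    let ?D = "v \<bullet> (hessf (z + s *\<^sub>R w) *v w) - v \<bullet> (hessf z *v w) - C * s"
    have "(?\<chi> has_field_derivative ?D) (at s)"
      by (auto intro!: derivative_eq_intros gradient_has_field_derivative_along_line[OF f])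
    moreover have "?D \<le> 0"
    proof -
      have "norm ((hessf (z + s *\<^sub>R w) - hessf z) *v w) \<le> L * norm (s *\<^sub>R w) * norm w"
        using norm_mult_spectral_norm_le[of "hessf (z + s *\<^sub>R w) - hessf z" w]
          mult_right_mono[OF hess[of "z + s *\<^sub>R w" z] norm_ge_zero[of w]] by simp
      then have "norm v * norm ((hessf (z + s *\<^sub>R w) - hessf z) *v w) \<le> C * s"
        using s mult_left_mono[of "norm ((hessf (z + s *\<^sub>R w) - hessf z) *v w)"
            "L * norm (s *\<^sub>R w) * norm w" "norm v"]
        by (simp add: C_def power2_eq_square mult_ac)
      moreover have "v \<bullet> ((hessf (z + s *\<^sub>R w) - hessf z) *v w)
          \<le> norm v * norm ((hessf (z + s *\<^sub>R w) - hessf z) *v w)"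
        by (rule norm_cauchy_schwarz)
      ultimately show ?thesis
        by (simp add: matrix_vector_mult_diff_rdistrib inner_diff_right)
    qed
    ultimately show "\<exists>D. (?\<chi> has_field_derivative D) (at s) \<and> D \<le> 0" by blast
  qed simp
  then have "v \<bullet> gradf (z + w) - v \<bullet> (hessf z *v w) - C / 2 \<le> v \<bullet> gradf z"
    by simp
  moreover have "v \<bullet> (gradf (z + w) - gradf z - hessf z *v w) = v \<bullet> v"
    by (simp add: v_def w_def)
  ultimately have "norm v * norm v \<le> norm v * (L / 2 * (norm w)\<^sup>2)"
    by (simp add: C_def inner_diff_right mult_ac dot_square_norm power2_eq_square)
  then have "norm v \<le> L / 2 * (norm w)\<^sup>2 \<or> norm v = 0"
    by (metis mult_le_cancel_left_pos norm_ge_zero order_less_le)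
  moreover have "0 \<le> L * norm w"
    using hess[of y z] onorm_pos_le[OF matrix_vector_mul_bounded_linear, of "hessf y - hessf z"]
    by (simp add: w_def spectral_norm_def)
  then have "0 \<le> L / 2 * (norm w)\<^sup>2"
    using mult_nonneg_nonneg[of "L * norm w" "norm w"] by (simp add: power2_eq_square mult.assoc)
  ultimately show ?thesis by (auto simp: v_def w_def)
qed

text \<open>
  The usual descent lemma has the constant \<open>L / 2\<close>. The cruder constant comes directly from the mean
  value theorem and only affects the lower bound on the step sizes.
\<close>

lemma lipschitz_gradient_upper_bound:
  fixes f :: "real^'n \<Rightarrow> real"
  assumes f: "C2_fun f gradf hessf" and lip: "L-lipschitz_on UNIV gradf"
  shows "f (y + w) - f y \<le> gradf y \<bullet> w + L * (norm w)\<^sup>2"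
proof -
  obtain s :: real where s: "0 < s" "s < 1"
    and eq: "f (y + 1 *\<^sub>R w) - f (y + 0 *\<^sub>R w) = (1 - 0) * (gradf (y + s *\<^sub>R w) \<bullet> w)"
    using MVT2[OF zero_less_one has_field_derivative_along_line[OF f, of y w]] by blast
  have L: "0 \<le> L" using lip by (simp add: lipschitz_on_def)
  have "(gradf (y + s *\<^sub>R w) - gradf y) \<bullet> w \<le> norm (gradf (y + s *\<^sub>R w) - gradf y) * norm w"
    by (rule norm_cauchy_schwarz)
  also have "\<dots> \<le> (L * norm (s *\<^sub>R w)) * norm w"
    using lipschitz_onD[OF lip, of "y + s *\<^sub>R w" y]
    by (intro mult_right_mono) (auto simp: dist_norm)
  also have "\<dots> \<le> L * (norm w)\<^sup>2"
    using s L mult_right_mono[of s 1 "L * (norm w)\<^sup>2"] by (simp add: power2_eq_square mult_ac)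
  finally show ?thesis using eq by (simp add: inner_diff_left)
qed

text \<open>Taylor's formula with Lagrange remainder along a line.\<close>

lemma second_order_expansion:
  fixes f :: "real^'n \<Rightarrow> real"
  assumes f: "C2_fun f gradf hessf"
  obtains s where "0 < s" "s < 1"
    "f (y + w) - f y = gradf y \<bullet> w + 1/2 * (w \<bullet> (hessf (y + s *\<^sub>R w) *v w))"
proof -
  define D where "D = (\<lambda>m s. if m = 0 then f (y + s *\<^sub>R w) else if m = Suc 0 then gradf (y + s *\<^sub>R w) \<bullet> w
      else w \<bullet> (hessf (y + s *\<^sub>R w) *v w))"
  have "\<forall>m s. m < (2::nat) \<and> 0 \<le> s \<and> s \<le> 1 \<longrightarrow> (D m has_field_derivative D (Suc m) s) (at s)"
    using has_field_derivative_along_line[OF f, of y w]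
      gradient_has_field_derivative_along_line[OF f, of w y w]
    by (auto simp: D_def less_2_cases_iff inner_commute[of "gradf _"])
  from Maclaurin[OF zero_less_one _ _ this, of "D 0"] obtain s where "0 < s" "s < 1"
    "D 0 1 = (\<Sum>m<2. D m 0 / fact m * 1 ^ m) + D 2 s / fact 2 * 1 ^ 2" by auto
  then show thesis
    by (intro that[of s]) (auto simp: D_def numeral_2_eq_2)
qed


section \<open>The convex part\<close>

lemma convex_fun_segment:
  assumes h: "convex_fun h" and "h y \<le> ereal a" "h z \<le> ereal b" "0 \<le> s" "s \<le> 1"
  shows "h (y + s *\<^sub>R (z - y)) \<le> ereal (a + s * (b - a))"
proof -
  have "(1 - s) *\<^sub>R (y, a) + s *\<^sub>R (z, b) \<in> ereal_epigraph h"
    using assms by (intro convexD[OF h[unfolded convex_fun_def]]) (auto simp: ereal_epigraph_def)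
  then show ?thesis by (simp add: ereal_epigraph_def algebra_simps)
qed

text \<open>
  Fermat's rule \<open>- \<nabla>\<phi>(y) \<in> \<partial>h(y)\<close> for a minimizer \<open>y\<close> of \<open>\<phi> + h\<close>, where \<open>h\<close> is convex and \<open>\<phi>\<close> is
  differentiable but need not be convex. The subgradient inequality is stated for one point \<open>z\<close> of
  the domain, with the finite values of \<open>h\<close> as real numbers.
\<close>

lemma minimizer_imp_subgradient:
  fixes \<phi> :: "'a::real_inner \<Rightarrow> real"
  assumes h: "convex_fun h" and \<phi>: "GDERIV \<phi> y :> G"
    and min: "\<And>z. ereal (\<phi> y) + h y \<le> ereal (\<phi> z) + h z"
    and fin: "h y = ereal a" "h z = ereal b"
  shows "a - G \<bullet> (z - y) \<le> b"
proof -
  define w where "w = z - y"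
  have "((\<lambda>s. \<phi> (y + s *\<^sub>R w)) has_derivative (\<lambda>r. (r *\<^sub>R w) \<bullet> G)) (at 0)"
    by (rule has_derivative_compose[of _ _ _ _ \<phi>])
      (use \<phi> in \<open>auto intro!: derivative_eq_intros simp: gderiv_def\<close>)
  then have "((\<lambda>s. \<phi> (y + s *\<^sub>R w)) has_field_derivative w \<bullet> G) (at 0)"
    by (simp add: has_field_derivative_def mult.commute[of _ "w \<bullet> G"])
  then have "((\<lambda>s. (\<phi> (y + s *\<^sub>R w) - \<phi> y) / s) \<longlongrightarrow> w \<bullet> G) (at_right 0)"
    by (auto simp: has_field_derivative_iff intro: tendsto_within_subset)
  moreover have "\<forall>\<^sub>F s in at_right 0. a - b \<le> (\<phi> (y + s *\<^sub>R w) - \<phi> y) / s"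
    unfolding eventually_at_right_field
  proof (intro exI[of _ 1] conjI allI impI)
    fix s :: real
    assume s: "0 < s" "s < 1"
    have "ereal (\<phi> y) + ereal a \<le> ereal (\<phi> (y + s *\<^sub>R w)) + h (y + s *\<^sub>R w)"
      using min[of "y + s *\<^sub>R w"] fin by simp
    also have "\<dots> \<le> ereal (\<phi> (y + s *\<^sub>R w)) + ereal (a + s * (b - a))"
      using convex_fun_segment[OF h, of y a z b s] s fin by (intro add_left_mono) (simp add: w_def)
    finally have "ereal (\<phi> y) + ereal a \<le> ereal (\<phi> (y + s *\<^sub>R w)) + ereal (a + s * (b - a))" .
    then show "a - b \<le> (\<phi> (y + s *\<^sub>R w) - \<phi> y) / s"
      using s by (simp add: field_simps)
  qed simp
  ultimately have "a - b \<le> w \<bullet> G"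
    by (intro tendsto_lowerbound) auto
  then show ?thesis by (simp add: w_def inner_commute)
qed

lemma subproblem_minimizer_imp_subgradient:
  fixes H :: "real^'n^'n"
  assumes h: "convex_fun h" and H: "transpose H = H"
    and min: "is_arg_min (subproblem_obj h x g H) (\<lambda>_. True) d"
    and fin: "h (x + d) = ereal a" "h z = ereal b"
  shows "a - (g + H *v d) \<bullet> (z - (x + d)) \<le> b"
proof (rule minimizer_imp_subgradient[OF h])
  let ?\<phi> = "\<lambda>y. g \<bullet> (y - x) + 1/2 * ((y - x) \<bullet> (H *v (y - x)))"
  have sym: "u \<bullet> (H *v v) = v \<bullet> (H *v u)" for u v
    using H by (metis dot_lmul_matrix inner_commute transpose_matrix_vector)
  have "((\<lambda>y. H *v (y - x)) has_derivative (\<lambda>v. H *v v)) (at (x + d))"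
    by (rule bounded_linear.has_derivative[OF matrix_vector_mul_bounded_linear])
      (auto intro!: derivative_eq_intros)
  then have "(?\<phi> has_derivative (\<lambda>v. g \<bullet> v
      + 1/2 * ((x + d - x) \<bullet> (H *v v) + v \<bullet> (H *v (x + d - x))))) (at (x + d))"
    by (intro has_derivative_add has_derivative_mult_right has_derivative_inner
        has_derivative_inner_right) (auto intro!: derivative_eq_intros)
  then show "GDERIV ?\<phi> (x + d) :> g + H *v d"
    unfolding gderiv_def
    by (rule has_derivative_eq_rhs) (simp add: fun_eq_iff inner_add_right inner_commute[of g] sym[of d])
  show "ereal (?\<phi> (x + d)) + h (x + d) \<le> ereal (?\<phi> z) + h z" for z
    using min[unfolded is_arg_min_linorder] by (auto simp: subproblem_obj_def dest: spec[of _ "z - x"])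
qed (use fin in auto)


section \<open>The line search\<close>

lemma linesearch_cond_iff:
  fixes h :: "real^'n \<Rightarrow> ereal"
  assumes "h x = ereal a" "h (x + d) = ereal b" "h (x + t *\<^sub>R d) = ereal c"
  shows "linesearch_cond f h c1 c2 x g d \<Delta> t \<longleftrightarrow>
    f (x + t *\<^sub>R d) + c - (f x + a) \<le> c1 * t * (g \<bullet> d + b - a) + real CARD('n) * c2 * \<Delta>\<^sup>2"
  using assms by (simp add: linesearch_cond_def composite_obj_def predicted_decrease_def)

text \<open>
  A sufficient condition for accepting the step \<open>t\<close>, given an upper model of \<open>f\<close> along \<open>d\<close> with
  remainder \<open>r\<close> and with the exact gradient \<open>G\<close>. Replacing \<open>G\<close> by its approximation \<open>g\<close> costs at most
  \<open>\<kappa> \<Delta> \<parallel>d\<parallel> \<le> \<kappa>\<^sup>2 \<Delta>\<^sup>2 / \<sigma> + (\<sigma> / 4) \<parallel>d\<parallel>\<^sup>2\<close>; the first term is covered by the relaxation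
  \<open>n c\<^sub>2 \<Delta>\<^sup>2\<close> of the test, the second must be covered by the decrease. The lemma is used twice: with a
  first-order model and small \<open>t\<close>, and with a second-order model and \<open>t = 1\<close>.
\<close>

lemma linesearch_condI:
  fixes h :: "real^'n \<Rightarrow> ereal"
  assumes h: "convex_fun h" "\<And>y. h y \<noteq> -\<infinity>"
    and fin: "h x = ereal a" "h (x + d) = ereal b"
    and t: "0 \<le> t" "t \<le> 1" and \<Delta>: "0 \<le> \<Delta>"
    and acc: "norm (g - G) \<le> \<kappa> * \<Delta>"
    and \<sigma>: "0 < \<sigma>" "\<kappa>\<^sup>2 \<le> real CARD('n) * c2 * \<sigma>"
    and model: "f (x + t *\<^sub>R d) - f x \<le> t * (G \<bullet> d) + r"
    and r: "(1 - c1) * t * (g \<bullet> d + b - a) + r + t * (\<sigma> / 4 * (norm d)\<^sup>2) \<le> 0"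
  shows "linesearch_cond f h c1 c2 x g d \<Delta> t"
proof -
  have up: "h (x + t *\<^sub>R d) \<le> ereal (a + t * (b - a))"
    using convex_fun_segment[OF h(1), of x a "x + d" b t] fin t by simp
  then obtain c where c: "h (x + t *\<^sub>R d) = ereal c"
    using h(2) by (cases "h (x + t *\<^sub>R d)") auto
  have "(G - g) \<bullet> d \<le> norm (g - G) * norm d"
    by (metis norm_cauchy_schwarz norm_minus_commute)
  also have "\<dots> \<le> \<kappa> * \<Delta> * norm d"
    using acc by (intro mult_right_mono) auto
  also have "\<dots> \<le> \<kappa>\<^sup>2 * \<Delta>\<^sup>2 / \<sigma> + \<sigma> / 4 * (norm d)\<^sup>2"
  proof -
    have "0 \<le> (\<kappa> * \<Delta> - \<sigma> / 2 * norm d)\<^sup>2 / \<sigma>" using \<sigma> by simp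
    also have "\<dots> = \<kappa>\<^sup>2 * \<Delta>\<^sup>2 / \<sigma> + \<sigma> / 4 * (norm d)\<^sup>2 - \<kappa> * \<Delta> * norm d"
      using \<sigma> by (simp add: power2_eq_square field_simps)
    finally show ?thesis by simp
  qed
  also have "\<kappa>\<^sup>2 * \<Delta>\<^sup>2 / \<sigma> \<le> real CARD('n) * c2 * \<Delta>\<^sup>2"
    using mult_right_mono[OF \<sigma>(2), of "\<Delta>\<^sup>2"] \<sigma>(1) by (simp add: field_simps)
  finally have "t * ((G - g) \<bullet> d) \<le> t * (real CARD('n) * c2 * \<Delta>\<^sup>2 + \<sigma> / 4 * (norm d)\<^sup>2)"
    using t by (intro mult_left_mono) auto
  also have "\<dots> \<le> real CARD('n) * c2 * \<Delta>\<^sup>2 + t * (\<sigma> / 4 * (norm d)\<^sup>2)"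
  proof -
    have "0 \<le> real CARD('n) * c2 * \<sigma>" using \<sigma>(2) zero_le_power2[of \<kappa>] by linarith
    then have "0 \<le> real CARD('n) * c2 * \<Delta>\<^sup>2" using \<sigma>(1) by (auto simp: zero_le_mult_iff)
    from mult_right_mono[OF t(2) this] show ?thesis by (simp add: algebra_simps)
  qed
  finally show ?thesis
    using model r up unfolding linesearch_cond_iff[of h, OF fin c]
    by (simp add: c inner_diff_left algebra_simps)
qed


section \<open>Perturbed superlinear recursions\<close>

lemma ratio_tendsto_0_imp_tendsto_0:
  fixes a :: "nat \<Rightarrow> real"
  assumes pos: "\<And>k. 0 < a k" and ratio: "(\<lambda>k. a (Suc k) / a k) \<longlonglongrightarrow> 0"
  shows "a \<longlonglongrightarrow> 0"
proof -
  have "\<forall>\<^sub>F k in sequentially. a (Suc k) / a k < 1/2"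
    using ratio by (rule order_tendstoD) simp
  then obtain N where N: "\<And>k. k \<ge> N \<Longrightarrow> a (Suc k) / a k < 1/2"
    by (auto simp: eventually_sequentially)
  have "summable a"
    by (rule summable_ratio_test[of "1/2" N])
      (use N pos in \<open>auto simp: divide_less_eq abs_of_pos intro!: less_imp_le\<close>)
  then show ?thesis by (rule summable_LIMSEQ_zero)
qed

text \<open>
  The majorant solves \<open>a\<^sub>k\<^sub>+\<^sub>1 = C \<Delta>\<^sub>k + \<theta>\<^sub>k a\<^sub>k\<close>. Its quotients tend to \<open>0\<close> because
  \<open>a\<^sub>k \<ge> C \<Delta>\<^sub>k\<^sub>-\<^sub>1\<close>, whence \<open>a\<^sub>k\<^sub>+\<^sub>1 / a\<^sub>k \<le> \<Delta>\<^sub>k / \<Delta>\<^sub>k\<^sub>-\<^sub>1 + \<theta>\<^sub>k\<close>.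
\<close>

lemma perturbed_superlinear_recursion:
  fixes e \<Delta> \<theta> :: "nat \<Rightarrow> real"
  assumes \<Delta>: "Q_superlinear_to_0 \<Delta>" and C: "0 < C"
    and \<theta>: "\<theta> \<longlonglongrightarrow> 0" "\<And>k. 0 \<le> \<theta> k"
    and rec: "\<forall>\<^sub>F k in sequentially. e (Suc k) \<le> C * \<Delta> k + \<theta> k * e k"
  shows "\<exists>a. Q_superlinear_to_0 a \<and> (\<forall>\<^sub>F k in sequentially. e k \<le> a k)"
proof -
  obtain K where K: "\<And>k. k \<ge> K \<Longrightarrow> e (Suc k) \<le> C * \<Delta> k + \<theta> k * e k"
    using rec by (auto simp: eventually_sequentially)
  have \<Delta>_pos: "0 < \<Delta> k" for k using \<Delta> by (simp add: Q_superlinear_to_0_def)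
  \<comment> \<open>The recursion holds from \<open>K\<close> on, so the majorant is kept constant up to index \<open>K\<close> and
    started there from a positive bound for \<open>e K\<close>.\<close>
  define M where "M = max 1 (e K)"
  define a where "a = rec_nat M (\<lambda>k r. if k < K then M else C * \<Delta> k + \<theta> k * r)"
  have a_0: "a 0 = M" and a_Suc: "a (Suc k) = (if k < K then M else C * \<Delta> k + \<theta> k * a k)" for k
    by (simp_all add: a_def)
  have pos: "0 < a k" for k
    by (induction k) (auto simp: a_0 a_Suc M_def \<Delta>_pos C \<theta>(2) intro!: add_pos_nonneg)
  have dom: "e k \<le> a k" if "K \<le> k" for k
    using that
  proof (induction k rule: dec_induct)
    case base
    have "a K = M" by (cases K) (auto simp: a_0 a_Suc)
    then show ?case by (simp add: M_def)
  next
    case (step k)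
    then show ?case
      using K[of k] mult_left_mono[OF step.IH \<theta>(2)[of k]] by (simp add: a_Suc)
  qed
  have "(\<lambda>k. a (Suc k) / a k) \<longlonglongrightarrow> 0"
  proof (rule LIMSEQ_imp_Suc, rule tendsto_sandwich)
    show "\<forall>\<^sub>F k in sequentially. 0 \<le> a (Suc (Suc k)) / a (Suc k)"
      using pos by (simp add: less_imp_le)
    show "\<forall>\<^sub>F k in sequentially. a (Suc (Suc k)) / a (Suc k) \<le> \<Delta> (Suc k) / \<Delta> k + \<theta> (Suc k)"
      using eventually_ge_at_top[of K]
    proof eventually_elim
      case (elim k)
      have "C * \<Delta> k \<le> a (Suc k)"
        using elim pos[of k] \<theta>(2)[of k] by (simp add: a_Suc)
      then have "C * \<Delta> (Suc k) / a (Suc k) \<le> C * \<Delta> (Suc k) / (C * \<Delta> k)"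
        using C \<Delta>_pos by (intro divide_left_mono) (auto simp: pos intro!: mult_pos_pos less_imp_le)
      moreover have "a (Suc (Suc k)) / a (Suc k) = C * \<Delta> (Suc k) / a (Suc k) + \<theta> (Suc k)"
        using elim pos[of "Suc k"] unfolding a_Suc[of "Suc k"] by (simp add: add_divide_distrib)
      ultimately show ?case using C by simp
    qed
    show "(\<lambda>k. \<Delta> (Suc k) / \<Delta> k + \<theta> (Suc k)) \<longlonglongrightarrow> 0"
      using \<Delta> LIMSEQ_Suc[OF \<theta>(1)] by (auto simp: Q_superlinear_to_0_def intro: tendsto_add_zero)
  qed simp
  then have "Q_superlinear_to_0 a"
    unfolding Q_superlinear_to_0_def using pos ratio_tendsto_0_imp_tendsto_0[of a] by blast
  with dom show ?thesis unfolding eventually_sequentially by blast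
qed


section \<open>Convergence of the algorithm\<close>

lemma subproblem_minimizer_in_domain:
  assumes "is_arg_min (subproblem_obj h x g H) (\<lambda>_. True) d" "h x < \<infinity>"
  shows "h (x + d) < \<infinity>"
proof -
  have "subproblem_obj h x g H d \<le> subproblem_obj h x g H 0"
    using assms(1) by (simp add: is_arg_min_linorder)
  then show ?thesis using assms(2) by (auto simp: subproblem_obj_def)
qed

text \<open>
  The error of one unit step. In \<open>g + H d - \<nabla>f(x\<^sup>\<star>)\<close> the main term is \<open>\<nabla>\<^sup>2f(x\<^sup>\<star>) (x + d - x\<^sup>\<star>)\<close>; the
  rest \<open>u\<close> consists of the gradient error, the Dennis--More error along \<open>d\<close> and the linearization
  error of \<open>\<nabla>f\<close> at \<open>x\<^sup>\<star>\<close>.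
\<close>

lemma proximal_newton_step_error:
  fixes f :: "real^'n \<Rightarrow> real"
  assumes f: "C2_fun f gradf hessf" and hess_lower: "\<mu> *\<^sub>R mat 1 \<preceq>\<^sub>L hessf xs"
    and hess_lip: "\<And>y z. spectral_norm (hessf y - hessf z) \<le> L * norm (y - z)"
    and opt: "(g + H *v d - gradf xs) \<bullet> (x + d - xs) \<le> 0"
    and acc: "norm (g - gradf x) \<le> \<delta>"
    and dm: "norm ((H - hessf xs) *v d) \<le> \<rho> * norm d" and \<rho>: "0 \<le> \<rho>"
  shows "(\<mu> - \<rho>) * norm (x + d - xs)
    \<le> \<delta> + \<rho> * norm (x - xs) + L / 2 * (norm (x - xs))\<^sup>2"
proof -
  define w where "w = x + d - xs"
  define R where "R = gradf x - gradf xs - hessf xs *v (x - xs)"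
  define u where "u = (g - gradf x) + (H - hessf xs) *v d + R"
  have eq: "g + H *v d - gradf xs = u + hessf xs *v w"
    by (simp add: u_def R_def w_def algebra_simps matrix_vector_right_distrib
        matrix_vector_mult_diff_rdistrib matrix_vector_mult_diff_distrib)
  have "norm d \<le> norm w + norm (x - xs)"
    using norm_triangle_ineq4[of w "x - xs"] by (simp add: w_def)
  then have "\<rho> * norm d \<le> \<rho> * norm w + \<rho> * norm (x - xs)"
    using mult_left_mono[of "norm d" "norm w + norm (x - xs)", OF _ \<rho>] by (simp add: distrib_left)
  moreover have "norm R \<le> L / 2 * (norm (x - xs))\<^sup>2"
    unfolding R_def by (rule gradient_linearization_error[OF f hess_lip])
  ultimately have u: "norm u \<le> \<delta> + \<rho> * norm w + \<rho> * norm (x - xs) + L / 2 * (norm (x - xs))\<^sup>2"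
    unfolding u_def
    using norm_triangle_ineq[of "g - gradf x + (H - hessf xs) *v d" R]
      norm_triangle_ineq[of "g - gradf x" "(H - hessf xs) *v d"] acc dm by linarith
  have "\<mu> * (norm w)\<^sup>2 \<le> w \<bullet> (hessf xs *v w)"
    using hess_lower
    by (simp add: loewner_le_def scaleR_matrix_vector_assoc[symmetric] dot_square_norm)
  also have "\<dots> \<le> - (u \<bullet> w)"
    using opt unfolding eq
    by (simp add: inner_add_left inner_commute[of "hessf xs *v w"] flip: w_def)
  also have "\<dots> \<le> norm u * norm w"
    using norm_cauchy_schwarz[of "- u" w] by simp
  finally have "norm w * (\<mu> * norm w) \<le> norm w * norm u"
    by (simp add: power2_eq_square mult_ac)
  then have "\<mu> * norm w \<le> norm u"
    by (cases "w = 0") auto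
  with u show ?thesis by (simp add: w_def[symmetric] left_diff_distrib)
qed

text \<open>
  A global bound, used to obtain convergence of the iterates from \<open>d \<rightarrow> 0\<close>. The size of \<open>H d\<close> is
  controlled by comparing \<open>H\<close> with a fixed matrix \<open>B\<close> along \<open>d\<close>.
\<close>

lemma proximal_newton_residual_bound:
  fixes f :: "real^'n \<Rightarrow> real"
  assumes f: "C2_fun f gradf hessf" and hess_lower: "\<And>y. \<mu> *\<^sub>R mat 1 \<preceq>\<^sub>L hessf y"
    and lip: "L-lipschitz_on UNIV gradf"
    and opt: "(g + H *v d - gradf xs) \<bullet> (x + d - xs) \<le> 0"
    and acc: "norm (g - gradf x) \<le> \<delta>"
    and dm: "norm ((H - B) *v d) \<le> \<rho> * norm d"
  shows "\<mu> * norm (x + d - xs) \<le> \<delta> + (\<rho> + spectral_norm B + L) * norm d"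
proof -
  define w where "w = x + d - xs"
  define u where "u = (g - gradf x) + (H - B) *v d + B *v d + (gradf x - gradf (x + d))"
  have eq: "g + H *v d - gradf xs = u + (gradf (x + d) - gradf xs)"
    by (simp add: u_def matrix_vector_mult_diff_rdistrib)
  have "norm (gradf x - gradf (x + d)) \<le> L * norm d"
    using lipschitz_onD[OF lip, of x "x + d"] by (simp add: dist_norm)
  then have u: "norm u \<le> \<delta> + (\<rho> + spectral_norm B + L) * norm d"
    unfolding u_def using acc dm norm_mult_spectral_norm_le[of B d]
      norm_triangle_ineq[of "g - gradf x" "(H - B) *v d"]
      norm_triangle_ineq[of "g - gradf x + (H - B) *v d" "B *v d"]
      norm_triangle_ineq[of "g - gradf x + (H - B) *v d + B *v d" "gradf x - gradf (x + d)"]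
    by (simp add: distrib_right)
  have "\<mu> * (norm w)\<^sup>2 \<le> (gradf (x + d) - gradf xs) \<bullet> w"
    unfolding w_def by (rule gradient_strongly_monotone[OF f hess_lower])
  also have "\<dots> \<le> - (u \<bullet> w)"
    using opt unfolding eq by (simp add: inner_add_left flip: w_def)
  also have "\<dots> \<le> norm u * norm w"
    using norm_cauchy_schwarz[of "- u" w] by simp
  finally have "norm w * (\<mu> * norm w) \<le> norm w * norm u"
    by (simp add: power2_eq_square mult_ac)
  then have "\<mu> * norm w \<le> norm u"
    by (cases "w = 0") auto
  with u show ?thesis by (simp add: w_def)
qed

theorem theorem4p4:
  fixes f :: "real^'n \<Rightarrow> real"
    and gradf :: "real^'n \<Rightarrow> real^'n"
    and hessf :: "real^'n \<Rightarrow> real^'n^'n"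
    and h :: "real^'n \<Rightarrow> ereal"
    and g d x :: "nat \<Rightarrow> real^'n"
    and H :: "nat \<Rightarrow> real^'n^'n"
    and \<Delta> t \<rho> :: "nat \<Rightarrow> real"
    and xstar :: "real^'n"
    and c1 c2 \<beta> L\<^sub>f L\<^sub>H \<mu> \<kappa>eg \<kappa>lo \<kappa>up :: real
  assumes f_C2: "C2_fun f gradf hessf"
    and Lf_pos: "L\<^sub>f > 0"
    and grad_lipschitz: "L\<^sub>f-lipschitz_on UNIV gradf"
    and mu_pos: "\<mu> > 0"
    and strong_convexity: "\<And>y. \<mu> *\<^sub>R mat 1 \<preceq>\<^sub>L hessf y"
    and LH_pos: "L\<^sub>H > 0"
    and hess_lipschitz: "\<And>y z. spectral_norm (hessf y - hessf z) \<le> L\<^sub>H * norm (y - z)"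
    and h_proper: "proper_fun h"
    and h_closed: "closed_fun h"
    and h_convex: "convex_fun h"
    and F_bounded_below: "\<exists>m::real. \<forall>y. ereal m \<le> composite_obj f h y"
    and xstar_min: "is_arg_min (composite_obj f h) (\<lambda>_. True) xstar"
    and run: "ZOPN_run f h c1 c2 \<beta> \<Delta> g H d t x"
    and keg_pos: "\<kappa>eg > 0"
    and grad_accuracy: "\<And>k. norm (g k - gradf (x k)) \<le> \<kappa>eg * \<Delta> k"
    and kappa_bounds: "0 < \<kappa>lo" "\<kappa>lo \<le> \<kappa>up"
    and H_lower: "\<And>k. \<kappa>lo *\<^sub>R mat 1 \<preceq>\<^sub>L H k"
    and H_upper: "\<And>k. H k \<preceq>\<^sub>L \<kappa>up *\<^sub>R mat 1"
    and rho_def: "\<And>k. \<rho> k = dennis_more_ratio H (hessf xstar) x k"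
    and dennis_more: "\<rho> \<longlonglongrightarrow> 0"
    and c2_bound: "c2 \<ge> \<kappa>eg\<^sup>2 / (real CARD('n) * \<kappa>lo * (1 - 2 * c1))"
    and Delta_summable: "summable (\<lambda>k. (\<Delta> k)\<^sup>2)"
  shows "(\<forall>\<^sub>F k in sequentially.
           norm (x (Suc k) - xstar)
             \<le> sqrt 2 * \<kappa>eg / (\<mu> - sqrt 2 * \<rho> k) * \<Delta> k
               + sqrt 2 * (L\<^sub>H * norm (d k) + \<rho> k) / (\<mu> - sqrt 2 * \<rho> k) * norm (x k - xstar)
               + L\<^sub>H / (2 * \<mu>) * (1 + sqrt 2 * \<rho> k / (\<mu> - sqrt 2 * \<rho> k)) * (norm (x k - xstar))\<^sup>2)
       \<and> (Q_superlinear_to_0 \<Delta> \<longrightarrow> R_superlinear_to x xstar)"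
proof -
  from run have c1: "0 < c1" "c1 < 1/2" and c2: "0 < c2" and \<beta>: "0 < \<beta>" "\<beta> < 1"
    and x0: "x 0 \<in> eff_domain (composite_obj f h)"
    and \<Delta>_pos: "\<And>k. 0 < \<Delta> k"
    and spd: "\<And>k. sym_pos_def (H k)"
    and d_min: "\<And>k. is_arg_min (subproblem_obj h (x k) (g k) (H k)) (\<lambda>_. True) (d k)"
    and step: "\<And>k. \<exists>i. t k = \<beta> ^ i \<and>
               linesearch_cond f h c1 c2 (x k) (g k) (d k) (\<Delta> k) (\<beta> ^ i) \<and>
               (\<forall>j<i. \<not> linesearch_cond f h c1 c2 (x k) (g k) (d k) (\<Delta> k) (\<beta> ^ j))"
    and x_Suc: "\<And>k. x (Suc k) = x k + t k *\<^sub>R d k"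
    by (simp_all add: ZOPN_run_def)
  have h_gt: "h y \<noteq> -\<infinity>" for y using h_proper by (simp add: proper_fun_def)
  have t_pos: "0 < t k" and t_le: "t k \<le> 1" for k
    using step[of k] \<beta> by (auto simp: power_le_one)
  have ls: "linesearch_cond f h c1 c2 (x k) (g k) (d k) (\<Delta> k) (t k)" for k
    using step[of k] by auto

  have dom: "h (x k) < \<infinity>" for k
  proof (induction k)
    case 0
    then show ?case using x0 by (simp add: eff_domain_def composite_obj_def)
  next
    case (Suc k)
    obtain a where a: "h (x k) = ereal a" using Suc h_gt[of "x k"] by (cases "h (x k)") auto
    obtain b where b: "h (x k + d k) = ereal b"
      using subproblem_minimizer_in_domain[OF d_min[of k] Suc] h_gt[of "x k + d k"]
      by (cases "h (x k + d k)") auto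
    have "h (x (Suc k)) \<le> ereal (a + t k * (b - a))"
      using convex_fun_segment[OF h_convex, of "x k" a "x k + d k" b "t k"] a b t_pos[of k] t_le[of k]
      by (simp add: x_Suc)
    then show ?case by auto
  qed
  \<comment> \<open>From here on all values of \<open>h\<close> that occur are finite: \<open>a k\<close> at the iterate, \<open>b k\<close> at the
    full step.\<close>
  define a where "a k = real_of_ereal (h (x k))" for k
  define b where "b k = real_of_ereal (h (x k + d k))" for k
  have a: "h (x k) = ereal (a k)" for k
    using dom[of k] h_gt[of "x k"] by (cases "h (x k)") (auto simp: a_def)
  have b: "h (x k + d k) = ereal (b k)" for k
    using subproblem_minimizer_in_domain[OF d_min[of k] dom[of k]] h_gt[of "x k + d k"]
    by (cases "h (x k + d k)") (auto simp: b_def)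
  have F_star: "ereal (f xstar) + h xstar \<le> ereal (f z) + h z" for z
    using xstar_min by (simp add: is_arg_min_linorder composite_obj_def)
  obtain as where as: "h xstar = ereal as"
    using F_star[of "x 0"] a[of 0] h_gt[of xstar] by (cases "h xstar") auto

  define \<Phi> where "\<Phi> k = g k \<bullet> d k + b k - a k" for k
  have \<Phi>_le: "\<Phi> k \<le> - (d k \<bullet> (H k *v d k))" for k
    using subproblem_minimizer_imp_subgradient[OF h_convex _ d_min[of k] b[of k] a[of k]] spd[of k]
    by (simp add: \<Phi>_def sym_pos_def_def inner_add_right inner_commute)
  have H_ge: "\<kappa>lo * (norm (d k))\<^sup>2 \<le> d k \<bullet> (H k *v d k)" for k
    using H_lower[of k]
    by (simp add: loewner_le_def scaleR_matrix_vector_assoc[symmetric] dot_square_norm)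
  \<comment> \<open>Monotonicity of the subdifferential of \<open>h\<close> between the full step and the minimizer.\<close>
  have opt: "(g k + H k *v d k - gradf xstar) \<bullet> (x k + d k - xstar) \<le> 0" for k
  proof -
    have "b k - (g k + H k *v d k) \<bullet> (xstar - (x k + d k)) \<le> as"
      using subproblem_minimizer_imp_subgradient[OF h_convex _ d_min[of k] b[of k] as] spd[of k]
      by (simp add: sym_pos_def_def)
    moreover have "as - gradf xstar \<bullet> (x k + d k - xstar) \<le> b k"
      using minimizer_imp_subgradient[OF h_convex _ F_star as b[of k]] f_C2 by (simp add: C2_fun_def)
    moreover have "(g k + H k *v d k) \<bullet> (xstar - (x k + d k)) = - ((g k + H k *v d k) \<bullet> (x k + d k - xstar))"
      by (metis inner_minus_right minus_diff_eq)
    ultimately show ?thesis by (simp add: inner_diff_left)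
  qed

  have \<rho>_nonneg: "0 \<le> \<rho> k" for k by (simp add: rho_def dennis_more_ratio_def)
  \<comment> \<open>The ratio is invariant under scaling of the direction, so it does not see the step size; when
    the step is zero, \<open>d k = 0\<close> since \<open>t k > 0\<close>.\<close>
  have dm: "norm ((H k - hessf xstar) *v d k) \<le> \<rho> k * norm (d k)" for k
    using t_pos[of k] by (auto simp: rho_def dennis_more_ratio_def x_Suc matrix_vector_mult_scaleR)

  define \<sigma> where "\<sigma> = \<kappa>lo * (1 - 2 * c1)"
  have \<sigma>: "0 < \<sigma>" using kappa_bounds c1 by (simp add: \<sigma>_def)
  have "\<kappa>eg\<^sup>2 / (real CARD('n) * \<sigma>) \<le> c2"
    using c2_bound by (simp add: \<sigma>_def mult.assoc)
  then have \<kappa>_le: "\<kappa>eg\<^sup>2 \<le> real CARD('n) * c2 * \<sigma>"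
    using \<sigma> by (simp add: pos_divide_le_eq mult_ac)

  have accept_small: "linesearch_cond f h c1 c2 (x k) (g k) (d k) (\<Delta> k) s"
    if s: "0 \<le> s" "s \<le> 1" "L\<^sub>f * s \<le> \<kappa>lo / 2" for k s
  proof (rule linesearch_condI[OF h_convex h_gt a b s(1,2) less_imp_le[OF \<Delta>_pos] grad_accuracy \<sigma> \<kappa>_le])
    show "f (x k + s *\<^sub>R d k) - f (x k) \<le> s * (gradf (x k) \<bullet> d k) + s * (L\<^sub>f * s * (norm (d k))\<^sup>2)"
      using lipschitz_gradient_upper_bound[OF f_C2 grad_lipschitz, of "x k" "s *\<^sub>R d k"]
      by (simp add: power2_eq_square mult_ac)
    have "(1 - c1) * \<Phi> k \<le> (1 - c1) * (- (\<kappa>lo * (norm (d k))\<^sup>2))"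
      using c1 \<Phi>_le[of k] H_ge[of k] by (intro mult_left_mono) auto
    moreover have "L\<^sub>f * s * (norm (d k))\<^sup>2 \<le> \<kappa>lo / 2 * (norm (d k))\<^sup>2"
      using s by (intro mult_right_mono) auto
    moreover have "(- (1 - c1) * \<kappa>lo + \<kappa>lo / 2 + \<sigma> / 4) * (norm (d k))\<^sup>2 \<le> 0"
    proof (rule mult_nonpos_nonneg)
      have "- (1 - c1) * \<kappa>lo + \<kappa>lo / 2 + \<sigma> / 4 = - \<sigma> / 4"
        by (simp add: \<sigma>_def field_simps)
      then show "- (1 - c1) * \<kappa>lo + \<kappa>lo / 2 + \<sigma> / 4 \<le> 0" using \<sigma> by simp
    qed simp
    ultimately have "(1 - c1) * \<Phi> k + L\<^sub>f * s * (norm (d k))\<^sup>2 + \<sigma> / 4 * (norm (d k))\<^sup>2 \<le> 0"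
      by (simp add: algebra_simps)
    from mult_left_mono[OF this s(1)]
    show "(1 - c1) * s * (g k \<bullet> d k + b k - a k) + s * (L\<^sub>f * s * (norm (d k))\<^sup>2)
        + s * (\<sigma> / 4 * (norm (d k))\<^sup>2) \<le> 0"
      by (simp add: \<Phi>_def algebra_simps)
  qed

  \<comment> \<open>If backtracking took place, the step before the accepted one was rejected, so it was larger
    than \<open>\<kappa>lo / (2 L\<^sub>f)\<close>.\<close>
  define \<tau> where "\<tau> = min 1 (\<beta> * (\<kappa>lo / (2 * L\<^sub>f)))"
  have \<tau>: "0 < \<tau>" using \<beta> kappa_bounds Lf_pos by (simp add: \<tau>_def)
  have t_ge: "\<tau> \<le> t k" for k
  proof -
    obtain i where i: "t k = \<beta> ^ i"
      "\<forall>j<i. \<not> linesearch_cond f h c1 c2 (x k) (g k) (d k) (\<Delta> k) (\<beta> ^ j)"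
      using step[of k] by blast
    show ?thesis
    proof (cases i)
      case 0
      then show ?thesis using i by (simp add: \<tau>_def)
    next
      case (Suc j)
      have "\<not> L\<^sub>f * \<beta> ^ j \<le> \<kappa>lo / 2"
        using accept_small[of "\<beta> ^ j" k] i(2) Suc \<beta> by (auto simp: power_le_one)
      then have "\<kappa>lo / (2 * L\<^sub>f) \<le> \<beta> ^ j" using Lf_pos by (simp add: field_simps)
      then have "\<beta> * (\<kappa>lo / (2 * L\<^sub>f)) \<le> t k"
        using \<beta> i Suc by (simp only: power_Suc) (intro mult_left_mono, auto)
      then show ?thesis by (simp add: \<tau>_def)
    qed
  qed

  have descent: "f (x (Suc k)) + a (Suc k)
      \<le> f (x k) + a k - c1 * \<tau> * \<kappa>lo * (norm (d k))\<^sup>2 + real CARD('n) * c2 * (\<Delta> k)\<^sup>2" for k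
  proof -
    have "f (x (Suc k)) + a (Suc k) - (f (x k) + a k) \<le> c1 * t k * \<Phi> k + real CARD('n) * c2 * (\<Delta> k)\<^sup>2"
      using ls[of k] linesearch_cond_iff[of h, OF a b a[of "Suc k", unfolded x_Suc]]
      by (simp add: x_Suc \<Phi>_def)
    moreover have "c1 * t k * \<Phi> k \<le> c1 * t k * (- (\<kappa>lo * (norm (d k))\<^sup>2))"
      using c1 t_pos[of k] \<Phi>_le[of k] H_ge[of k] by (intro mult_left_mono) auto
    moreover have "c1 * \<tau> * (\<kappa>lo * (norm (d k))\<^sup>2) \<le> c1 * t k * (\<kappa>lo * (norm (d k))\<^sup>2)"
      using c1 t_ge[of k] kappa_bounds by (intro mult_right_mono mult_left_mono) auto
    ultimately show ?thesis by (simp add: mult_ac)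
  qed
  obtain m where m: "\<And>k. m \<le> f (x k) + a k"
    using F_bounded_below by (metis a composite_obj_def ereal_less_eq(3) plus_ereal.simps(1))
  have "summable (\<lambda>k. c1 * \<tau> * \<kappa>lo * (norm (d k))\<^sup>2)"
  proof (rule bounded_imp_summable)
    show "0 \<le> c1 * \<tau> * \<kappa>lo * (norm (d k))\<^sup>2" for k using c1 \<tau> kappa_bounds by simp
    fix N
    have "(\<Sum>k<N. c1 * \<tau> * \<kappa>lo * (norm (d k))\<^sup>2)
        \<le> f (x 0) + a 0 - (f (x N) + a N) + real CARD('n) * c2 * (\<Sum>k<N. (\<Delta> k)\<^sup>2)" for N
    proof (induction N)
      case (Suc N)
      then show ?case using descent[of N] by (simp add: distrib_left)
    qed simp
    from this[of "Suc N"] have "(\<Sum>k<Suc N. c1 * \<tau> * \<kappa>lo * (norm (d k))\<^sup>2)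
        \<le> f (x 0) + a 0 - m + real CARD('n) * c2 * (\<Sum>k<Suc N. (\<Delta> k)\<^sup>2)"
      using m[of "Suc N"] by linarith
    also have "\<dots> \<le> f (x 0) + a 0 - m + real CARD('n) * c2 * (\<Sum>k. (\<Delta> k)\<^sup>2)"
      using c2 by (intro add_left_mono mult_left_mono sum_le_suminf[OF Delta_summable]) auto
    finally show "(\<Sum>k\<le>N. c1 * \<tau> * \<kappa>lo * (norm (d k))\<^sup>2)
        \<le> f (x 0) + a 0 - m + real CARD('n) * c2 * (\<Sum>k. (\<Delta> k)\<^sup>2)"
      by (simp add: lessThan_Suc_atMost)
  qed
  then have "(\<lambda>k. (norm (d k))\<^sup>2) \<longlonglongrightarrow> 0"
    using c1 \<tau> kappa_bounds by (intro summable_LIMSEQ_zero) (simp add: summable_cmult_iff)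
  then have d_lim: "(\<lambda>k. norm (d k)) \<longlonglongrightarrow> 0"
    using tendsto_real_sqrt[of _ 0] by fastforce
  have \<Delta>_lim: "\<Delta> \<longlonglongrightarrow> 0"
    using tendsto_real_sqrt[OF summable_LIMSEQ_zero[OF Delta_summable]] \<Delta>_pos
    by (simp add: less_imp_le)

  have y_lim: "(\<lambda>k. norm (x k + d k - xstar)) \<longlonglongrightarrow> 0"
  proof (rule tendsto_sandwich[where f="\<lambda>_. 0"])
    let ?r = "\<lambda>k. (\<kappa>eg * \<Delta> k + (\<rho> k + spectral_norm (hessf xstar) + L\<^sub>f) * norm (d k)) / \<mu>"
    show "\<forall>\<^sub>F k in sequentially. norm (x k + d k - xstar) \<le> ?r k"
      using proximal_newton_residual_bound[OF f_C2 strong_convexity grad_lipschitz opt grad_accuracy dm]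
        mu_pos by (simp add: pos_le_divide_eq mult.commute)
    have "?r \<longlonglongrightarrow> (\<kappa>eg * 0 + (0 + spectral_norm (hessf xstar) + L\<^sub>f) * 0) / \<mu>"
      by (intro tendsto_intros \<Delta>_lim dennis_more d_lim) (use mu_pos in auto)
    then show "?r \<longlonglongrightarrow> 0" by simp
  qed auto
  have x_lim: "(\<lambda>k. norm (x k - xstar)) \<longlonglongrightarrow> 0"
  proof (rule tendsto_sandwich[where f="\<lambda>_. 0"])
    have "norm (x k - xstar) \<le> norm (x k + d k - xstar) + norm (d k)" for k
      using norm_triangle_ineq4[of "x k + d k - xstar" "d k"] by simp
    then show "\<forall>\<^sub>F k in sequentially. norm (x k - xstar) \<le> norm (x k + d k - xstar) + norm (d k)"
      by simp
    show "(\<lambda>k. norm (x k + d k - xstar) + norm (d k)) \<longlonglongrightarrow> 0"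
      using y_lim d_lim by (rule tendsto_add_zero)
  qed auto

  \<comment> \<open>\<open>\<epsilon> k\<close> bounds the relative difference along \<open>d k\<close> between \<open>H k\<close> and the Hessian at any point of
    the segment from \<open>x k\<close> to \<open>x k + d k\<close>.\<close>
  define \<epsilon> where "\<epsilon> k = \<rho> k + L\<^sub>H * (norm (x k - xstar) + norm (d k))" for k
  have "\<epsilon> \<longlonglongrightarrow> 0 + L\<^sub>H * (0 + 0)"
    unfolding \<epsilon>_def by (intro tendsto_intros dennis_more x_lim d_lim)
  then have \<epsilon>_small: "\<forall>\<^sub>F k in sequentially. \<epsilon> k < \<sigma> / 2"
    using \<sigma> by (intro order_tendstoD) auto
  have unit_step: "\<forall>\<^sub>F k in sequentially. t k = 1"
    using \<epsilon>_small
  proof eventually_elim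
    case (elim k)
    obtain s where s: "0 < s" "s < 1" and exp:
      "f (x k + d k) - f (x k) = gradf (x k) \<bullet> d k + 1/2 * (d k \<bullet> (hessf (x k + s *\<^sub>R d k) *v d k))"
      by (rule second_order_expansion[OF f_C2, of "x k" "d k"])
    define D1 where "D1 = (hessf (x k + s *\<^sub>R d k) - hessf xstar) *v d k"
    define D2 where "D2 = (H k - hessf xstar) *v d k"
    have "norm (x k + s *\<^sub>R d k - xstar) \<le> norm (x k - xstar) + norm (s *\<^sub>R d k)"
      using norm_triangle_ineq[of "x k - xstar" "s *\<^sub>R d k"] by (simp add: algebra_simps)
    also have "\<dots> \<le> norm (x k - xstar) + norm (d k)"
      using s by (simp add: mult_left_le_one_le)
    finally have "L\<^sub>H * norm (x k + s *\<^sub>R d k - xstar) \<le> L\<^sub>H * (norm (x k - xstar) + norm (d k))"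
      using LH_pos by simp
    then have "spectral_norm (hessf (x k + s *\<^sub>R d k) - hessf xstar)
        \<le> L\<^sub>H * (norm (x k - xstar) + norm (d k))"
      using hess_lipschitz order_trans by blast
    then have "norm D1 \<le> L\<^sub>H * (norm (x k - xstar) + norm (d k)) * norm (d k)"
      unfolding D1_def by (rule order_trans[OF norm_mult_spectral_norm_le mult_right_mono]) simp
    then have "norm (D1 - D2) \<le> \<epsilon> k * norm (d k)"
      using norm_triangle_ineq4[of D1 D2] dm[of k] by (simp add: \<epsilon>_def D2_def distrib_right)
    then have "norm (d k) * norm (D1 - D2) \<le> norm (d k) * (\<epsilon> k * norm (d k))"
      by (rule mult_left_mono) simp
    moreover have "d k \<bullet> (D1 - D2) \<le> norm (d k) * norm (D1 - D2)"
      by (rule norm_cauchy_schwarz)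
    moreover have "d k \<bullet> (D1 - D2) = d k \<bullet> (hessf (x k + s *\<^sub>R d k) *v d k) - d k \<bullet> (H k *v d k)"
      by (simp add: D1_def D2_def matrix_vector_mult_diff_rdistrib inner_diff_right)
    moreover have "\<epsilon> k * (norm (d k))\<^sup>2 \<le> \<sigma> / 2 * (norm (d k))\<^sup>2"
      using elim by (intro mult_right_mono) auto
    ultimately have curv: "d k \<bullet> (hessf (x k + s *\<^sub>R d k) *v d k)
        \<le> d k \<bullet> (H k *v d k) + \<sigma> / 2 * (norm (d k))\<^sup>2"
      by (simp add: power2_eq_square mult_ac)
    have "linesearch_cond f h c1 c2 (x k) (g k) (d k) (\<Delta> k) 1"
    proof (rule linesearch_condI[OF h_convex h_gt a b _ _ less_imp_le[OF \<Delta>_pos] grad_accuracy \<sigma> \<kappa>_le])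
      show "f (x k + 1 *\<^sub>R d k) - f (x k)
          \<le> 1 * (gradf (x k) \<bullet> d k) + 1/2 * (d k \<bullet> (hessf (x k + s *\<^sub>R d k) *v d k))"
        using exp by simp
      have "(1 - c1) * \<Phi> k \<le> (1 - c1) * (- (d k \<bullet> (H k *v d k)))"
        using c1 \<Phi>_le[of k] by (intro mult_left_mono) auto
      moreover have "(1/2 - c1) * (\<kappa>lo * (norm (d k))\<^sup>2) \<le> (1/2 - c1) * (d k \<bullet> (H k *v d k))"
        using c1 H_ge[of k] by (intro mult_left_mono) auto
      moreover have "(1/2 - c1) * (\<kappa>lo * (norm (d k))\<^sup>2) = \<sigma> / 2 * (norm (d k))\<^sup>2"
        by (simp add: \<sigma>_def field_simps)
      ultimately have "(1 - c1) * \<Phi> k + 1/2 * (d k \<bullet> (hessf (x k + s *\<^sub>R d k) *v d k))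
          + \<sigma> / 4 * (norm (d k))\<^sup>2 \<le> 0"
        using curv by (simp add: left_diff_distrib)
      then show "(1 - c1) * 1 * (g k \<bullet> d k + b k - a k)
          + 1/2 * (d k \<bullet> (hessf (x k + s *\<^sub>R d k) *v d k)) + 1 * (\<sigma> / 4 * (norm (d k))\<^sup>2) \<le> 0"
        by (simp add: \<Phi>_def)
    qed auto
    moreover obtain i where "t k = \<beta> ^ i"
      "\<forall>j<i. \<not> linesearch_cond f h c1 c2 (x k) (g k) (d k) (\<Delta> k) (\<beta> ^ j)"
      using step[of k] by blast
    ultimately show "t k = 1" by (cases i) (auto dest: spec[of _ 0])
  qed

  have main: "\<forall>\<^sub>F k in sequentially. (\<mu> - \<rho> k) * norm (x (Suc k) - xstar)
      \<le> \<kappa>eg * \<Delta> k + \<rho> k * norm (x k - xstar) + L\<^sub>H / 2 * (norm (x k - xstar))\<^sup>2"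
    using unit_step
  proof eventually_elim
    case (elim k)
    then show ?case
      using proximal_newton_step_error[OF f_C2 strong_convexity hess_lipschitz opt grad_accuracy dm \<rho>_nonneg]
      by (simp add: x_Suc)
  qed
  \<comment> \<open>Since \<open>sqrt 2 \<le> 2\<close>, this makes both \<open>\<mu> - \<rho> k\<close> and \<open>\<mu> - sqrt 2 * \<rho> k\<close> at least \<open>\<mu> / 2\<close>.\<close>
  have \<rho>_small: "\<forall>\<^sub>F k in sequentially. \<rho> k < \<mu> / 4"
    using dennis_more mu_pos by (intro order_tendstoD) auto

  have "\<forall>\<^sub>F k in sequentially. norm (x (Suc k) - xstar)
             \<le> sqrt 2 * \<kappa>eg / (\<mu> - sqrt 2 * \<rho> k) * \<Delta> k
               + sqrt 2 * (L\<^sub>H * norm (d k) + \<rho> k) / (\<mu> - sqrt 2 * \<rho> k) * norm (x k - xstar)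
               + L\<^sub>H / (2 * \<mu>) * (1 + sqrt 2 * \<rho> k / (\<mu> - sqrt 2 * \<rho> k)) * (norm (x k - xstar))\<^sup>2"
    using main \<rho>_small
  proof eventually_elim
    case (elim k)
    define e where "e = norm (x k - xstar)"
    define E where "E = norm (x (Suc k) - xstar)"
    define M where "M = \<mu> - sqrt 2 * \<rho> k"
    have sqrt2: "1 \<le> sqrt 2" "sqrt 2 \<le> 2" by (auto intro: real_le_lsqrt)
    have "sqrt 2 * \<rho> k \<le> 2 * \<rho> k" "1 * \<rho> k \<le> sqrt 2 * \<rho> k"
      using sqrt2 \<rho>_nonneg[of k] by (intro mult_right_mono; simp)+
    then have M: "0 < M" "M \<le> \<mu> - \<rho> k" using elim(2) mu_pos by (auto simp: M_def)
    have "M * E \<le> (\<mu> - \<rho> k) * E" using M by (intro mult_right_mono) (auto simp: E_def)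
    also have "\<dots> \<le> 1 * (\<kappa>eg * \<Delta> k) + 1 * (\<rho> k * e) + L\<^sub>H / 2 * e\<^sup>2"
      using elim(1) by (simp add: e_def E_def)
    also have "\<dots> \<le> sqrt 2 * (\<kappa>eg * \<Delta> k) + sqrt 2 * ((L\<^sub>H * norm (d k) + \<rho> k) * e) + L\<^sub>H / 2 * e\<^sup>2"
      using sqrt2 keg_pos \<Delta>_pos[of k] \<rho>_nonneg[of k] LH_pos
      by (intro add_mono mult_mono) (auto simp: e_def)
    finally have "E \<le> (sqrt 2 * (\<kappa>eg * \<Delta> k) + sqrt 2 * ((L\<^sub>H * norm (d k) + \<rho> k) * e) + L\<^sub>H / 2 * e\<^sup>2) / M"
      using M(1) by (simp add: pos_le_divide_eq mult.commute)
    also have "\<dots> = sqrt 2 * \<kappa>eg / M * \<Delta> k + sqrt 2 * (L\<^sub>H * norm (d k) + \<rho> k) / M * e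
        + L\<^sub>H / 2 / M * e\<^sup>2"
      by (simp add: add_divide_distrib mult_ac)
    also have "L\<^sub>H / 2 / M = L\<^sub>H / (2 * \<mu>) * (1 + sqrt 2 * \<rho> k / M)"
    proof -
      have "1 + sqrt 2 * \<rho> k / M = \<mu> / M" using M(1) by (simp add: M_def field_simps)
      then show ?thesis using mu_pos by simp
    qed
    finally show ?case by (simp add: e_def E_def M_def)
  qed
  moreover have "R_superlinear_to x xstar" if "Q_superlinear_to_0 \<Delta>"
    unfolding R_superlinear_to_def
  proof (rule perturbed_superlinear_recursion[OF that])
    let ?\<theta> = "\<lambda>k. 2 / \<mu> * (\<rho> k + L\<^sub>H / 2 * norm (x k - xstar))"
    show "0 < 2 / \<mu> * \<kappa>eg" using mu_pos keg_pos by simp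
    have "?\<theta> \<longlonglongrightarrow> 2 / \<mu> * (0 + L\<^sub>H / 2 * 0)"
      by (intro tendsto_intros dennis_more x_lim)
    then show "?\<theta> \<longlonglongrightarrow> 0" by simp
    show "0 \<le> ?\<theta> k" for k using mu_pos LH_pos \<rho>_nonneg[of k] by simp
    show "\<forall>\<^sub>F k in sequentially. norm (x (Suc k) - xstar)
        \<le> 2 / \<mu> * \<kappa>eg * \<Delta> k + ?\<theta> k * norm (x k - xstar)"
      using main \<rho>_small
    proof eventually_elim
      case (elim k)
      have "\<mu> / 2 * norm (x (Suc k) - xstar) \<le> (\<mu> - \<rho> k) * norm (x (Suc k) - xstar)"
        using elim(2) mu_pos by (intro mult_right_mono) auto
      also note elim(1)
      finally show ?case using mu_pos by (simp add: field_simps power2_eq_square)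
    qed
  qed
  ultimately show ?thesis by blast
qed

end
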